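(* There exists a positive constant $c$ such that for all positive integers $m,n$ with $n \ge c\,m$, we have $r(B_m, B_n) = 2n+3$.
   Context: For a positive integer $k$, the book with $k$ pages, $B_k = K_1 + K_{1,k}$, is the graph consisting of $k$ triangles sharing a common edge. The book Ramsey number $r(B_m,B_n)$ is the smallest integer $r$ such that for every graph $G$ on $r$ vertices, either $G$ contains $B_m$ as a subgraph or the complement $\overline{G}$ contains $B_n$ as a subgraph. *)

theory Defs
  imports Complex_Main
begin

text \<open>A graph is a pair of a vertex set and a set of edges, the edges being two-element
  subsets of the vertex set.\<close>

type_synonym 'a graph = "'a set \<times> 'a set set"

abbreviation verts :: "'a graph \<Rightarrow> 'a set" where "verts G \<equiv> fst G"

abbreviation edges :: "'a graph \<Rightarrow> 'a set set" where "edges G \<equiv> snd G"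

definition all_pairs :: "'a set \<Rightarrow> 'a set set" where
  "all_pairs V = {e. e \<subseteq> V \<and> card e = 2}"

definition finite_simple_graph :: "'a graph \<Rightarrow> bool" where
  "finite_simple_graph G \<longleftrightarrow> finite (verts G) \<and> edges G \<subseteq> all_pairs (verts G)"

definition complement :: "'a graph \<Rightarrow> 'a graph" where
  "complement G = (verts G, all_pairs (verts G) - edges G)"

definition complete_graph :: "nat \<Rightarrow> nat graph" where
  "complete_graph n = ({..<n}, all_pairs {..<n})"

definition empty_graph :: "nat \<Rightarrow> nat graph" where
  "empty_graph n = ({..<n}, {})"

definition join :: "'a graph \<Rightarrow> 'b graph \<Rightarrow> ('a + 'b) graph" where
  "join G H = (verts G <+> verts H,
     (\<lambda>e. Inl ` e) ` edges G \<union> (\<lambda>e. Inr ` e) ` edges H \<union>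
     {{Inl x, Inr y} | x y. x \<in> verts G \<and> y \<in> verts H})"

definition complete_bipartite :: "nat \<Rightarrow> nat \<Rightarrow> (nat + nat) graph" where
  "complete_bipartite a b = join (empty_graph a) (empty_graph b)"

definition book :: "nat \<Rightarrow> (nat + (nat + nat)) graph" where
  "book k = join (complete_graph 1) (complete_bipartite 1 k)"

text \<open>Subgraphs are not required to be induced, and are taken up to isomorphism.\<close>

definition contains_subgraph :: "'a graph \<Rightarrow> 'b graph \<Rightarrow> bool" where
  "contains_subgraph G H \<longleftrightarrow>
     (\<exists>f. inj_on f (verts H) \<and> f ` verts H \<subseteq> verts G \<and> (\<forall>e\<in>edges H. f ` e \<in> edges G))"

text \<open>Since containment is invariant under isomorphism, it suffices to consider graphs whose
  vertices are natural numbers. An \<open>r\<close> as required below exists by Ramsey's theorem, so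
  that \<open>LEAST\<close> denotes the minimum.\<close>

definition book_ramsey :: "nat \<Rightarrow> nat \<Rightarrow> nat" where
  "book_ramsey m n = (LEAST r. \<forall>G :: nat graph.
     finite_simple_graph G \<and> card (verts G) = r \<longrightarrow>
       contains_subgraph G (book m) \<or> contains_subgraph (complement G) (book n))"

text \<open>The book consists of the triangles \<open>a b p\<close> over its pages \<open>p\<close>, where
  \<open>a = Inl 0\<close>, \<open>b = Inr (Inl 0)\<close> and \<open>p = Inr (Inr i)\<close>.\<close>

lemma verts_book: "verts (book k) = {Inl 0, Inr (Inl 0)} \<union> (\<lambda>i. Inr (Inr i)) ` {..<k}"
  by (auto simp: book_def complete_bipartite_def join_def complete_graph_def empty_graph_def)

lemma edges_book:
  "edges (book k) = insert {Inl 0, Inr (Inl 0)}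
     (\<Union>i<k. {{Inl 0, Inr (Inr i)}, {Inr (Inl 0), Inr (Inr i)}})"
proof -
  have "all_pairs {..<Suc 0} = {}"
    by (auto simp: all_pairs_def lessThan_Suc subset_singleton_iff)
  then show ?thesis
    by (auto simp: book_def complete_bipartite_def join_def complete_graph_def empty_graph_def
        image_iff) blast+
qed

end

theory Submission
  imports Defs
begin

text \<open>
  For the lower bound take two parts of size at most \<open>n + 1\<close>, joined completely.

  For the upper bound suppose that \<open>G\<close> has \<open>N = 2n + 3\<close> vertices and contains neither book. Write
  \<open>d\<close> for degrees and \<open>c\<close> for codegrees. Edges have codegree below \<open>m\<close>, and a non-edge \<open>uv\<close>
  satisfies \<open>d u + d v - c u v \<ge> n + 2\<close>. Summing the latter over all paths \<open>u x v\<close> and comparing,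
  by inclusion-exclusion, with the number of pairs of independent edges, the numbers of walks of
  length 3 and of closed walks of length 4 cancel; Cauchy-Schwarz for the degrees then shows that
  there are only \<open>O(m N\<^sup>3)\<close> induced pairs of independent edges. Hence, between two neighbourhoods
  \<open>N(u)\<close> and \<open>N(v)\<close> spanning many edges, \<open>G\<close> is close to a nested (half-graph like) bipartite
  graph, and such a graph contains a nearly complete pair \<open>(S, T)\<close> of sets of linear size.

  A nearly complete pair is impossible: its sides are independent, and a vertex with neighbours
  on both sides has few on each. So for suitable \<open>u, u' \<in> S\<close> and \<open>v, v' \<in> T\<close> every other vertex
  is, on average, a common non-neighbour of \<open>u, u'\<close> or of \<open>v, v'\<close>, which gives at least
  \<open>N - 4 > 2 (n - 1)\<close> in total.
\<close>

section \<open>Books as edges with many common neighbours\<close>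

text \<open>The images of the two spine vertices form the edge \<open>uv\<close>, and the pages are
  common neighbours of \<open>u\<close> and \<open>v\<close>. Conversely any \<open>k\<close> common
  neighbours serve as pages: they differ from \<open>u\<close> and \<open>v\<close> because edges
  have two elements.\<close>

lemma contains_book_iff:
  assumes "finite_simple_graph G"
  shows "contains_subgraph G (book k) \<longleftrightarrow>
    (\<exists>u v. {u, v} \<in> edges G \<and> k \<le> card {w. {u, w} \<in> edges G \<and> {v, w} \<in> edges G})"
    (is "?L \<longleftrightarrow> ?R")
proof -
  have sub: "e \<subseteq> verts G \<and> card e = 2" if "e \<in> edges G" for e
    using assms that by (auto simp: finite_simple_graph_def all_pairs_def)
  have fin: "finite {w. {u, w} \<in> edges G \<and> {v, w} \<in> edges G}" for u v
    by (rule finite_subset[of _ "verts G"])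
      (use sub assms in \<open>auto simp: finite_simple_graph_def\<close>)
  show ?thesis
  proof
    assume ?L
    then obtain f where inj: "inj_on f (verts (book k))"
      and f: "\<And>e. e \<in> edges (book k) \<Longrightarrow> f ` e \<in> edges G"
      unfolding contains_subgraph_def by blast
    let ?u = "f (Inl 0)" and ?v = "f (Inr (Inl 0))" and ?p = "\<lambda>i. f (Inr (Inr i))"
    have "f ` {Inl 0, Inr (Inl 0)} \<in> edges G"
      by (rule f) (simp add: edges_book)
    then have uv: "{?u, ?v} \<in> edges G" by simp
    have sub': "?p ` {..<k} \<subseteq> {w. {?u, w} \<in> edges G \<and> {?v, w} \<in> edges G}"
    proof
      fix w assume "w \<in> ?p ` {..<k}"
      then obtain i where i: "i < k" "w = ?p i" by auto
      have "f ` {Inl 0, Inr (Inr i)} \<in> edges G" "f ` {Inr (Inl 0), Inr (Inr i)} \<in> edges G"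
        by (rule f; use i in \<open>auto simp: edges_book\<close>)+
      then show "w \<in> {w. {?u, w} \<in> edges G \<and> {?v, w} \<in> edges G}" using i by simp
    qed
    have "inj_on ?p {..<k}"
      using inj by (auto simp: inj_on_def verts_book)
    then have "card (?p ` {..<k}) = k" by (simp add: card_image)
    then have "k \<le> card {w. {?u, w} \<in> edges G \<and> {?v, w} \<in> edges G}"
      using card_mono[OF fin sub'] by simp
    with uv show ?R by blast
  next
    assume ?R
    then obtain u v where uv: "{u, v} \<in> edges G"
      and k: "k \<le> card {w. {u, w} \<in> edges G \<and> {v, w} \<in> edges G}" by blast
    obtain W where W: "W \<subseteq> {w. {u, w} \<in> edges G \<and> {v, w} \<in> edges G}" "card W = k" "finite W"
      by (rule obtain_subset_with_card_n[OF k])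
    obtain g where g: "bij_betw g {..<k} W"
      using ex_bij_betw_nat_finite[OF W(3)] W(2) by (auto simp: atLeast0LessThan)
    have gW: "g i \<in> W" if "i < k" for i
      using bij_betwE[OF g] that by auto
    have ge: "{u, g i} \<in> edges G" "{v, g i} \<in> edges G" if "i < k" for i
      using gW[OF that] W(1) by auto
    have ne: "u \<noteq> v" "u \<in> verts G" "v \<in> verts G"
      using sub[OF uv] by (auto simp: card_insert_if split: if_splits)
    have gne: "g i \<noteq> u" "g i \<noteq> v" "g i \<in> verts G" if "i < k" for i
      using sub[OF ge(1)[OF that]] sub[OF ge(2)[OF that]]
      by (auto simp: card_insert_if split: if_splits)
    define f where "f = case_sum (\<lambda>_::nat. u) (case_sum (\<lambda>_::nat. v) g)"
    have f_simps [simp]: "f (Inl x) = u" "f (Inr (Inl y)) = v" "f (Inr (Inr i)) = g i" for x y i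
      by (simp_all add: f_def)
    have gi: "inj_on g {..<k}" using g by (simp add: bij_betw_def)
    have "inj_on f (verts (book k))"
      unfolding inj_on_def verts_book
      using ne gne inj_onD[OF gi] by (auto dest: sym)
    moreover have "f ` verts (book k) \<subseteq> verts G"
      using ne gne by (auto simp: verts_book)
    moreover have "\<forall>e\<in>edges (book k). f ` e \<in> edges G"
      using uv ge by (auto simp: edges_book)
    ultimately show ?L unfolding contains_subgraph_def by blast
  qed
qed

lemma finite_simple_graph_complement:
  assumes "finite_simple_graph G"
  shows "finite_simple_graph (complement G)"
  using assms by (auto simp: finite_simple_graph_def complement_def)

lemma pair_in_all_pairs: "{u, v} \<in> all_pairs V \<longleftrightarrow> u \<in> V \<and> v \<in> V \<and> u \<noteq> v"
  by (auto simp: all_pairs_def card_insert_if)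

section \<open>Lower bound\<close>

text \<open>The complete bipartite graph with parts \<open>{..n}\<close> and
  \<open>{n<..<r}\<close>, cut down to \<open>r\<close> vertices, is triangle-free. Its complement
  is a union of cliques on at most \<open>n + 1\<close> vertices, one short of a book with
  \<open>n\<close> pages. Minimality under \<open>LEAST\<close> asks for all \<open>r\<close> below
  \<open>2 * n + 3\<close>.\<close>

lemma book_ramsey_lower:
  assumes "m \<ge> 1" "r < 2 * n + 3"
  shows "\<exists>G :: nat graph. finite_simple_graph G \<and> card (verts G) = r \<and>
    \<not> contains_subgraph G (book m) \<and> \<not> contains_subgraph (complement G) (book n)"
proof -
  define G :: "nat graph" where "G = ({..<r}, {{x, y} |x y. x \<le> n \<and> n < y \<and> y < r})"
  have ed: "{u, v} \<in> edges G \<longleftrightarrow> u < r \<and> v < r \<and> (u \<le> n \<longleftrightarrow> \<not> v \<le> n)" for u v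
  proof -
    have "\<exists>x y. {u, v} = {x, y} \<and> x \<le> n \<and> n < y \<and> y < r"
      if "u < r" "v < r" "u \<le> n \<longleftrightarrow> \<not> v \<le> n"
      using that by (metis insert_commute not_le)
    then show ?thesis by (auto simp: G_def doubleton_eq_iff)
  qed
  have G: "finite_simple_graph G"
    by (auto simp: finite_simple_graph_def G_def pair_in_all_pairs)
  have cd: "{u, v} \<in> edges (complement G) \<longleftrightarrow>
      u < r \<and> v < r \<and> u \<noteq> v \<and> (u \<le> n \<longleftrightarrow> v \<le> n)" for u v
    using ed[of u v] by (auto simp: complement_def pair_in_all_pairs) (auto simp: G_def)
  have "\<not> contains_subgraph G (book m)"
  proof
    assume "contains_subgraph G (book m)"
    then obtain u v where uv: "{u, v} \<in> edges G"
      and m: "m \<le> card {w. {u, w} \<in> edges G \<and> {v, w} \<in> edges G}"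
      unfolding contains_book_iff[OF G] by blast
    have "{w. {u, w} \<in> edges G \<and> {v, w} \<in> edges G} = {}"
      using uv by (auto simp: ed)
    with m assms show False by simp
  qed
  moreover have "\<not> contains_subgraph (complement G) (book n)"
  proof
    assume "contains_subgraph (complement G) (book n)"
    then obtain u v where uv: "{u, v} \<in> edges (complement G)"
      and k: "n \<le> card {w. {u, w} \<in> edges (complement G) \<and> {v, w} \<in> edges (complement G)}"
        (is "_ \<le> card ?W")
      unfolding contains_book_iff[OF finite_simple_graph_complement[OF G]] by blast
    define I where "I = (if u \<le> n then {..n} else {n<..<r})"
    have I: "finite I" "card I \<le> n + 1" using assms by (auto simp: I_def)
    have uvI: "{u, v} \<subseteq> I" "u \<noteq> v" using uv by (auto simp: cd I_def)
    have "?W \<subseteq> I - {u, v}" using uv by (auto simp: cd I_def)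
    then have "n \<le> card (I - {u, v})"
      using k card_mono[of "I - {u, v}" ?W] I(1) by simp
    also have "\<dots> = card I - 2"
      using uvI by (subst card_Diff_subset) auto
    also have "\<dots> \<le> n - 1" using I by simp
    \<comment> \<open>Truncated subtraction lets \<open>n = 0\<close> survive; there a part has at
      most one vertex and cannot hold both \<open>u\<close> and \<open>v\<close>.\<close>
    finally have "n = 0" by simp
    have "card {u, v} \<le> card I" by (rule card_mono) (use I uvI in auto)
    with uvI I \<open>n = 0\<close> show False by simp
  qed
  ultimately show ?thesis using G by (intro exI[of _ G]) (auto simp: G_def)
qed

lemma exists_ge_average:
  fixes f :: "'a \<Rightarrow> real"
  assumes "finite A" "A \<noteq> {}"
  shows "\<exists>x\<in>A. sum f A \<le> card A * f x"
proof (rule ccontr)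
  assume "\<not> ?thesis"
  then have "\<And>x. x \<in> A \<Longrightarrow> card A * f x < sum f A" by auto
  then have "(\<Sum>x\<in>A. card A * f x) < (\<Sum>x\<in>A. sum f A)"
    using assms by (intro sum_strict_mono)
  then show False by (simp add: sum_distrib_left[symmetric])
qed

section \<open>Graphs avoiding both books\<close>

text \<open>Absence of the two books as codegree conditions. Since \<open>E\<close> is irreflexive,
  \<open>u\<close> and \<open>v\<close> would count as their own common non-neighbours, so
  \<open>nonedge\<close> removes them.\<close>

locale book_free =
  fixes V :: "'a set" and E :: "'a \<Rightarrow> 'a \<Rightarrow> bool" and m n :: nat
  assumes fin [simp]: "finite V"
    and card_V: "card V = 2 * n + 3"
    and sym: "E u v \<Longrightarrow> E v u"
    and irrefl [simp]: "\<not> E u u"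
    and edge: "\<lbrakk>u \<in> V; v \<in> V; E u v\<rbrakk> \<Longrightarrow> card {w \<in> V. E u w \<and> E v w} < m"
    and nonedge: "\<lbrakk>u \<in> V; v \<in> V; u \<noteq> v; \<not> E u v\<rbrakk> \<Longrightarrow>
      card {w \<in> V - {u, v}. \<not> E u w \<and> \<not> E v w} < n"
begin

lemma sym_iff: "E u v \<longleftrightarrow> E v u"
  using sym by blast

section \<open>Nearly complete pairs cannot exist\<close>

text \<open>A neighbour of \<open>z\<close> in \<open>T\<close> is either a common neighbour of the
  edge \<open>zu\<close>, of which there are fewer than \<open>m\<close>, or a non-neighbour of
  \<open>u\<close>. Each kind makes up at most a sixteenth of \<open>T\<close>.\<close>

lemma few_neighbours_across:
  assumes T: "S \<subseteq> V" "T \<subseteq> V" "16 * m \<le> card T"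
    and dense: "\<And>u. u \<in> S \<Longrightarrow> 16 * card {v \<in> T. \<not> E u v} \<le> card T"
    and z: "z \<in> V" "u \<in> S" "E z u"
  shows "8 * card {v \<in> T. E z v} \<le> card T"
proof -
  have fT: "finite T" using T(2) fin by (rule finite_subset)
  have "{v \<in> T. E z v} \<subseteq> {w \<in> V. E z w \<and> E u w} \<union> {v \<in> T. \<not> E u v}"
    using T by auto
  then have "card {v \<in> T. E z v} \<le> card ({w \<in> V. E z w \<and> E u w} \<union> {v \<in> T. \<not> E u v})"
    by (rule card_mono[rotated]) (use fT in auto)
  also have "\<dots> \<le> card {w \<in> V. E z w \<and> E u w} + card {v \<in> T. \<not> E u v}"
    by (rule card_Un_le)
  finally show ?thesis
    using edge[of z u] dense[of u] z T by auto
qed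

text \<open>An edge inside \<open>S\<close> would leave \<open>u\<close> with at most an eighth of
  \<open>T\<close> as neighbours, whereas \<open>u\<close> misses at most a sixteenth of
  \<open>T\<close>.\<close>

lemma independent_if_dense:
  assumes T: "S \<subseteq> V" "T \<subseteq> V" "16 * m \<le> card T" "T \<noteq> {}"
    and dense: "\<And>u. u \<in> S \<Longrightarrow> 16 * card {v \<in> T. \<not> E u v} \<le> card T"
    and u: "u \<in> S" "u' \<in> S"
  shows "\<not> E u u'"
proof
  assume e: "E u u'"
  have fT: "finite T" using T(2) fin by (rule finite_subset)
  have "8 * card {v \<in> T. E u v} \<le> card T"
    by (rule few_neighbours_across[OF T(1-3) dense]) (use u e T in auto)
  moreover have "card T = card {v \<in> T. E u v} + card {v \<in> T. \<not> E u v}"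
    by (subst card_Un_disjoint[symmetric]) (use fT in \<open>auto intro: arg_cong[where f = card]\<close>)
  moreover have "card T > 0" using fT T(4) by (simp add: card_gt_0_iff)
  ultimately show False using dense[OF u(1)] by linarith
qed

text \<open>Markov's inequality: the edge density between \<open>T\<close> and \<open>Y\<close> is
  at most 1/8, so at most half of \<open>T\<close> sees more than a quarter of \<open>Y\<close>, and
  the other half has at least two members.\<close>

lemma obtain_pair_few_neighbours:
  assumes T: "T \<subseteq> V" "4 \<le> card T" and Y: "Y \<subseteq> V"
    and few: "\<And>y. y \<in> Y \<Longrightarrow> 8 * card {u \<in> T. E y u} \<le> card T"
  obtains u u' where "u \<in> T" "u' \<in> T" "u \<noteq> u'"
    "4 * card {y \<in> Y. E u y} \<le> card Y" "4 * card {y \<in> Y. E u' y} \<le> card Y"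
proof -
  have f: "finite T" "finite Y" using T Y fin by (auto intro: finite_subset)
  define X where "X = {u \<in> T. card Y < 4 * card {y \<in> Y. E u y}}"
  \<comment> \<open>The strict inequality defining \<open>X\<close> gives the \<open>+ 1\<close>,
    which keeps the later comparison strict when \<open>Y\<close> is empty.\<close>
  have "card X * (card Y + 1) \<le> (\<Sum>u\<in>X. 4 * card {y \<in> Y. E u y})"
    using sum_mono[of X "\<lambda>_. card Y + 1" "\<lambda>u. 4 * card {y \<in> Y. E u y}"]
    by (auto simp: X_def)
  also have "\<dots> \<le> (\<Sum>u\<in>T. 4 * card {y \<in> Y. E u y})"
    by (rule sum_mono2) (auto simp: X_def f)
  also have "\<dots> = 4 * (\<Sum>y\<in>Y. card {u \<in> T. E u y})"
    using sum_multicount_gen[of T Y E "\<lambda>y. card {u \<in> T. E u y}"] f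
    by (simp add: sum_distrib_left[symmetric])
  finally have "2 * (card X * (card Y + 1)) \<le> (\<Sum>y\<in>Y. 8 * card {u \<in> T. E u y})"
    by (simp add: sum_distrib_left[symmetric])
  also have "\<dots> \<le> (\<Sum>y\<in>Y. card T)"
    using few by (intro sum_mono) (simp add: sym_iff)
  finally have le: "2 * card X * (card Y + 1) \<le> card Y * card T" by simp
  have "2 * card X \<le> card T"
  proof (rule ccontr)
    assume "\<not> ?thesis"
    then have "card T * (card Y + 1) < 2 * card X * (card Y + 1)"
      by (intro mult_strict_right_mono) auto
    with le show False by (simp add: algebra_simps)
  qed
  moreover have "card (T - X) = card T - card X"
    by (rule card_Diff_subset) (auto simp: X_def f)
  ultimately have "2 \<le> card (T - X)" using T by linarith
  then obtain P where P: "P \<subseteq> T - X" "card P = 2"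
    by (rule obtain_subset_with_card_n)
  then obtain u u' where "P = {u, u'}" "u \<noteq> u'" by (auto simp: card_2_iff)
  with P show ?thesis by (intro that[of u u']) (auto simp: X_def)
qed

lemma near_complete_pair_impossible:
  assumes T: "S \<subseteq> V" "T \<subseteq> V" "4 \<le> card S" "4 \<le> card T" "16 * m \<le> card S" "16 * m \<le> card T"
    and dS: "\<And>u. u \<in> S \<Longrightarrow> 16 * card {v \<in> T. \<not> E u v} \<le> card T"
    and dT: "\<And>v. v \<in> T \<Longrightarrow> 16 * card {u \<in> S. \<not> E v u} \<le> card S"
  shows False
proof -
  have ne: "S \<noteq> {}" "T \<noteq> {}" using T by auto
  \<comment> \<open>\<open>V\<close> splits into \<open>Z\<close>, \<open>Y\<close> and the rest,
    whose vertices have a neighbour in \<open>S\<close> and hence none in \<open>T\<close>.\<close>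
  define Y where "Y = {z \<in> V. (\<exists>u\<in>S. E z u) \<and> (\<exists>v\<in>T. E z v)}"
  define Z where "Z = {z \<in> V. \<forall>u\<in>S. \<not> E z u}"
  have Y: "Y \<subseteq> V" by (auto simp: Y_def)
  have YS: "8 * card {u \<in> S. E y u} \<le> card S" if "y \<in> Y" for y
    using that few_neighbours_across[OF T(2,1,5) dT] by (auto simp: Y_def)
  have YT: "8 * card {v \<in> T. E y v} \<le> card T" if "y \<in> Y" for y
    using that few_neighbours_across[OF T(1,2,6) dS] by (auto simp: Y_def)
  \<comment> \<open>Members of \<open>D\<close> or \<open>Y\<close> are common non-neighbours of
    \<open>u\<close> and \<open>u'\<close> (at most \<open>n - 1\<close>), one of these two
    vertices, or members of \<open>Y\<close> adjacent to one of them.\<close>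
  have many: "card (D \<union> Y) \<le> card {y \<in> Y. E u y} + card {y \<in> Y. E u' y} + n + 1"
    if u: "u \<in> V" "u' \<in> V" "u \<noteq> u'" "\<not> E u u'" and D: "D \<subseteq> V"
      "\<And>z. z \<in> D \<Longrightarrow> \<not> E u z \<and> \<not> E u' z" for u u' D
  proof -
    have "D \<union> Y \<subseteq> {w \<in> V - {u, u'}. \<not> E u w \<and> \<not> E u' w} \<union> {u, u'} \<union>
        {y \<in> Y. E u y} \<union> {y \<in> Y. E u' y}"
      using D Y by auto
    then have "card (D \<union> Y) \<le> card ({w \<in> V - {u, u'}. \<not> E u w \<and> \<not> E u' w} \<union> {u, u'} \<union>
        {y \<in> Y. E u y} \<union> {y \<in> Y. E u' y})"
      by (rule card_mono[rotated]) (use Y finite_subset[OF Y fin] in auto)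
    also have "\<dots> \<le> card {w \<in> V - {u, u'}. \<not> E u w \<and> \<not> E u' w} + card {u, u'} +
        card {y \<in> Y. E u y} + card {y \<in> Y. E u' y}"
      by (meson add_mono_thms_linordered_semiring(1) card_Un_le le_refl le_trans)
    also have "card {u, u'} = 2" using u by simp
    finally show ?thesis using nonedge[OF u] by linarith
  qed
  obtain u u' where u: "u \<in> S" "u' \<in> S" "u \<noteq> u'"
      "4 * card {y \<in> Y. E u y} \<le> card Y" "4 * card {y \<in> Y. E u' y} \<le> card Y"
    using obtain_pair_few_neighbours[OF T(1,3) Y YS] by metis
  obtain v v' where v: "v \<in> T" "v' \<in> T" "v \<noteq> v'"
      "4 * card {y \<in> Y. E v y} \<le> card Y" "4 * card {y \<in> Y. E v' y} \<le> card Y"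
    using obtain_pair_few_neighbours[OF T(2,4) Y YT] by metis
  have "\<not> E u u'" "\<not> E v v'"
    using independent_if_dense[OF T(1,2,6) ne(2) dS] independent_if_dense[OF T(2,1,5) ne(1) dT] u v
    by auto
  have "card (Z \<union> Y) \<le> card {y \<in> Y. E u y} + card {y \<in> Y. E u' y} + n + 1"
    by (rule many) (use u T \<open>\<not> E u u'\<close> in \<open>auto simp: Z_def sym_iff\<close>)
  moreover have "card ((V - Z - Y) \<union> Y) \<le> card {y \<in> Y. E v y} + card {y \<in> Y. E v' y} + n + 1"
    by (rule many) (use v T \<open>\<not> E v v'\<close> in \<open>auto simp: Z_def Y_def sym_iff\<close>)
  moreover have "card (Z \<union> Y) = card Z + card Y"
    by (rule card_Un_disjoint) (auto simp: Z_def Y_def)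
  moreover have "card ((V - Z - Y) \<union> Y) = card (V - Z - Y) + card Y"
    by (rule card_Un_disjoint) (auto simp: Y_def)
  moreover have "card V = card Z + card Y + card (V - Z - Y)"
  proof -
    have "V = Z \<union> Y \<union> (V - Z - Y)" by (auto simp: Z_def Y_def)
    also have "card \<dots> = card (Z \<union> Y) + card (V - Z - Y)"
      by (rule card_Un_disjoint) (auto simp: Z_def Y_def)
    finally show ?thesis using \<open>card (Z \<union> Y) = card Z + card Y\<close> by simp
  qed
  \<comment> \<open>Adding both bounds gives \<open>card V + card Y\<close> \<le>
    \<open>card Y + 2 * n + 2\<close>, against \<open>card V = 2 * n + 3\<close>.\<close>
  ultimately show False using u v card_V by linarith
qed

section \<open>Degrees, codegrees and walks\<close>

text \<open>The adjacency matrix over the reals. By symmetry \<open>c\<close> is its square, so the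
  diagonal entry \<open>c u u\<close> is \<open>d u\<close>.\<close>

definition a :: "'a \<Rightarrow> 'a \<Rightarrow> real" where "a u v = of_bool (E u v)"
definition d :: "'a \<Rightarrow> real" where "d u = (\<Sum>v\<in>V. a u v)"
definition c :: "'a \<Rightarrow> 'a \<Rightarrow> real" where "c u v = (\<Sum>w\<in>V. a u w * a v w)"
definition N :: real where "N = 2 * real n + 3"

lemma a_sym: "a u v = a v u"
  by (simp add: a_def sym_iff)

lemma a_bounds [simp]: "0 \<le> a u v" "a u v \<le> 1" "a u u = 0"
  by (simp_all add: a_def)

lemma c_sym: "c u v = c v u"
  by (simp add: c_def mult.commute)

lemma real_card_V: "real (card V) = N"
  by (simp add: card_V N_def)

lemma d_card: "d u = real (card {v \<in> V. E u v})"
  by (simp add: d_def a_def Int_def)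

lemma c_card: "c u v = real (card {w \<in> V. E u w \<and> E v w})"
  unfolding c_def a_def
  by (simp add: Int_def flip: of_bool_conj)

lemma d_bounds: "0 \<le> d u" "d u \<le> N"
proof -
  show "0 \<le> d u" by (simp add: d_card)
  have "card {v \<in> V. E u v} \<le> card V" by (rule card_mono) auto
  then show "d u \<le> N" by (simp add: d_card flip: real_card_V)
qed

lemma c_nonneg [simp]: "0 \<le> c u v"
  by (simp add: c_card)

lemma c_le_d: "c u v \<le> d u"
  unfolding c_def d_def by (intro sum_mono) (simp add: mult_left_le)

lemma c_edge: "\<lbrakk>u \<in> V; v \<in> V; E u v\<rbrakk> \<Longrightarrow> c u v \<le> m"
  using edge[of u v] by (simp add: c_card)

lemma a_c_le: "\<lbrakk>u \<in> V; v \<in> V\<rbrakk> \<Longrightarrow> a u v * c u v \<le> m"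
  using c_edge[of u v] by (simp add: a_def)

text \<open>Inclusion-exclusion: apart from \<open>u\<close>, \<open>v\<close> and at most
  \<open>n - 1\<close> common non-neighbours, all \<open>2 * n + 3\<close> vertices lie in the union
  of the two neighbourhoods.\<close>

lemma c_nonedge:
  assumes "u \<in> V" "v \<in> V" "u \<noteq> v" "\<not> E u v"
  shows "real n + 2 \<le> d u + d v - c u v"
proof -
  let ?W = "{w \<in> V - {u, v}. \<not> E u w \<and> \<not> E v w}"
  have "V = ({w \<in> V. E u w} \<union> {w \<in> V. E v w}) \<union> (?W \<union> {u, v})"
    using assms by auto
  then have "card V \<le> card ({w \<in> V. E u w} \<union> {w \<in> V. E v w}) + (card ?W + card {u, v})"
    by (metis (no_types, lifting) add_left_mono card_Un_le order_trans)
  moreover have "card {w \<in> V. E u w} + card {w \<in> V. E v w} =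
      card ({w \<in> V. E u w} \<union> {w \<in> V. E v w}) + card ({w \<in> V. E u w} \<inter> {w \<in> V. E v w})"
    by (rule card_Un_Int) auto
  moreover have "{w \<in> V. E u w} \<inter> {w \<in> V. E v w} = {w \<in> V. E u w \<and> E v w}" by auto
  moreover have "card {u, v} = 2" using assms by simp
  ultimately show ?thesis
    using nonedge[OF assms] card_V by (simp add: d_card c_card)
qed

lemma sum_c_row: "(\<Sum>v\<in>V. c u v) = (\<Sum>w\<in>V. a u w * d w)"
  unfolding c_def d_def
  by (subst sum.swap) (simp add: sum_distrib_left a_sym)

lemma sum_c: "(\<Sum>u\<in>V. \<Sum>v\<in>V. c u v) = (\<Sum>u\<in>V. (d u)\<^sup>2)"
proof -
  have "(\<Sum>u\<in>V. \<Sum>w\<in>V. a u w * d w) = (\<Sum>w\<in>V. \<Sum>u\<in>V. a w u * d w)"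
    by (subst sum.swap) (simp add: a_sym)
  then show ?thesis
    by (simp add: sum_c_row d_def power2_eq_square sum_distrib_right)
qed

text \<open>The numbers of walks of length 3 and of closed walks of length 4.\<close>

definition P :: real where "P = (\<Sum>u\<in>V. \<Sum>v\<in>V. a u v * d u * d v)"
definition Q :: real where "Q = (\<Sum>u\<in>V. \<Sum>v\<in>V. (c u v)\<^sup>2)"

text \<open>Prolonging a walk of length 2 at one end gives a walk of length 3, which
  \<open>P\<close> counts by its middle edge.\<close>

lemma sum_c_d: "(\<Sum>u\<in>V. \<Sum>v\<in>V. c u v * d u) = P" "(\<Sum>u\<in>V. \<Sum>v\<in>V. c u v * d v) = P"
proof -
  show 1: "(\<Sum>u\<in>V. \<Sum>v\<in>V. c u v * d u) = P"
    by (simp add: P_def sum_c_row sum_distrib_right[symmetric])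
       (simp add: sum_distrib_left sum_distrib_right mult_ac)
  show "(\<Sum>u\<in>V. \<Sum>v\<in>V. c u v * d v) = P"
    by (subst sum.swap) (simp add: c_sym 1[symmetric])
qed

text \<open>The non-edge inequality summed over all paths of length 2; edges and degenerate paths
  account for the error term.\<close>

lemma path_inequality:
  assumes "m \<ge> 1"
  shows "(real n + 2) * (\<Sum>u\<in>V. (d u)\<^sup>2) \<le> 2 * P - Q + 2 * m * N ^ 3"
proof -
  have N: "real n + 2 \<le> N" "0 \<le> N" by (simp_all add: N_def)
  \<comment> \<open>Distinct non-adjacent pairs contribute nonnegatively. Otherwise the bracket is
    at least \<open>- N\<close>, while \<open>c u v\<close> is at most \<open>m\<close> on edges and
    at most \<open>N\<close> on the diagonal.\<close>
  have pt: "- (m * N + of_bool (u = v) * N\<^sup>2) \<le> c u v * (d u + d v - c u v - (real n + 2))"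
    if uv: "u \<in> V" "v \<in> V" for u v
  proof -
    define X where "X = c u v * (d u + d v - c u v - (real n + 2))"
    have "0 \<le> d u + d v - c u v" using c_le_d[of u v] d_bounds(1)[of v] by linarith
    then have "c u v * (- N) \<le> X"
      unfolding X_def using N by (intro mult_left_mono) auto
    then have X: "- (c u v * N) \<le> X" by simp
    have nonneg: "0 \<le> m * N" "0 \<le> N\<^sup>2" using N by auto
    have "- (m * N + of_bool (u = v) * N\<^sup>2) \<le> X"
    proof (cases "u = v")
      case True
      have "c u v * N \<le> N\<^sup>2"
        using c_le_d[of u v] d_bounds(2)[of u] N by (simp add: power2_eq_square mult_right_mono)
      with X nonneg True show ?thesis by simp
    next
      case False
      show ?thesis
      proof (cases "E u v")
        case True
        have "c u v * N \<le> m * N"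
          using c_edge[OF uv True] N by (intro mult_right_mono)
        with X False show ?thesis by simp
      next
        case nonadj: False
        have "0 \<le> X" using c_nonedge[OF uv False nonadj] by (simp add: X_def)
        with nonneg False show ?thesis by simp
      qed
    qed
    then show ?thesis by (simp add: X_def)
  qed
  have "(\<Sum>u\<in>V. \<Sum>v\<in>V. - (m * N + of_bool (u = v) * N\<^sup>2)) \<le>
      (\<Sum>u\<in>V. \<Sum>v\<in>V. c u v * (d u + d v - c u v - (real n + 2)))"
    using pt by (intro sum_mono)
  also have "\<dots> = (\<Sum>u\<in>V. \<Sum>v\<in>V. c u v * d u + c u v * d v - (c u v)\<^sup>2 - c u v * (real n + 2))"
    by (simp add: algebra_simps power2_eq_square)
  also have "\<dots> = 2 * P - Q - (real n + 2) * (\<Sum>u\<in>V. (d u)\<^sup>2)"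
    unfolding sum.distrib sum_subtractf sum_c_d
    by (simp add: Q_def sum_c mult.commute flip: sum_distrib_right sum_distrib_left)
  finally have "(\<Sum>u\<in>V. \<Sum>v\<in>V. - (m * N + of_bool (u = v) * N\<^sup>2)) \<le>
      2 * P - Q - (real n + 2) * (\<Sum>u\<in>V. (d u)\<^sup>2)" .
  moreover have "(\<Sum>u\<in>V. \<Sum>v\<in>V. - (m * N + of_bool (u = v) * N\<^sup>2)) = - (m * N ^ 3 + N ^ 3)"
    by (simp add: sum.distrib sum_negf sum_subtractf real_card_V flip: sum_distrib_right)
       (simp add: algebra_simps power2_eq_square power3_eq_cube)
  \<comment> \<open>The diagonal costs \<open>N ^ 3\<close> in total, absorbed into a second
    \<open>m * N ^ 3\<close>.\<close>
  moreover have "1 * N ^ 3 \<le> m * N ^ 3"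
    using assms N by (intro mult_right_mono) auto
  ultimately show ?thesis by linarith
qed

section \<open>Counting induced pairs of independent edges\<close>

definition quad :: "('a \<Rightarrow> 'a \<Rightarrow> 'a \<Rightarrow> 'a \<Rightarrow> real) \<Rightarrow> real" where
  "quad F = (\<Sum>u\<in>V. \<Sum>v\<in>V. \<Sum>w\<in>V. \<Sum>z\<in>V. F u v w z)"

lemma quad_add: "quad (\<lambda>u v w z. F u v w z + G u v w z) = quad F + quad G"
  by (simp add: quad_def sum.distrib)

lemma quad_diff: "quad (\<lambda>u v w z. F u v w z - G u v w z) = quad F - quad G"
  by (simp add: quad_def sum_subtractf)

lemma quad_mono:
  "(\<And>u v w z. \<lbrakk>u \<in> V; v \<in> V; w \<in> V; z \<in> V\<rbrakk> \<Longrightarrow> F u v w z \<le> G u v w z) \<Longrightarrow> quad F \<le> quad G"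
  unfolding quad_def by (intro sum_mono)

lemma quad_swap12: "quad (\<lambda>u v w z. F v u w z) = quad F"
  unfolding quad_def by (rule sum.swap)

lemma quad_swap34: "quad (\<lambda>u v w z. F u v z w) = quad F"
  unfolding quad_def by (intro sum.cong refl sum.swap)

lemma quad_le:
  fixes F :: "'a \<Rightarrow> 'a \<Rightarrow> 'a \<Rightarrow> 'a \<Rightarrow> real"
  assumes "\<And>u v w. \<lbrakk>u \<in> V; v \<in> V; w \<in> V\<rbrakk> \<Longrightarrow> (\<Sum>z\<in>V. F u v w z) \<le> m"
  shows "quad F \<le> m * N ^ 3"
proof -
  have "quad F \<le> (\<Sum>u\<in>V. \<Sum>v\<in>V. \<Sum>w\<in>V. real m)"
    unfolding quad_def using assms by (intro sum_mono)
  then show ?thesis by (simp add: real_card_V power3_eq_cube mult_ac)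
qed

text \<open>Once \<open>u\<close>, \<open>v\<close>, \<open>w\<close> fix an edge, at most
  \<open>m\<close> vertices \<open>z\<close> complete it to a triangle. So patterns containing a
  triangle are negligible.\<close>

lemma quad_triangle:
  assumes "\<And>u v w z. \<lbrakk>u \<in> V; v \<in> V; w \<in> V; z \<in> V\<rbrakk> \<Longrightarrow>
      F u v w z \<le> a (f u v w) (g u v w) * a (f u v w) z * a (g u v w) z"
    and "\<And>u v w. \<lbrakk>u \<in> V; v \<in> V; w \<in> V\<rbrakk> \<Longrightarrow> f u v w \<in> V \<and> g u v w \<in> V"
  shows "quad F \<le> m * N ^ 3"
proof (rule quad_le)
  fix u v w assume uvw: "u \<in> V" "v \<in> V" "w \<in> V"
  let ?x = "f u v w" and ?y = "g u v w"
  have "(\<Sum>z\<in>V. F u v w z) \<le> (\<Sum>z\<in>V. a ?x ?y * a ?x z * a ?y z)"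
    using assms(1) uvw by (intro sum_mono)
  also have "\<dots> = a ?x ?y * c ?x ?y"
    by (simp add: c_def sum_distrib_left mult.assoc)
  also have "\<dots> \<le> m" using a_c_le assms(2)[OF uvw] by blast
  finally show "(\<Sum>z\<in>V. F u v w z) \<le> m" .
qed

lemma quad_path: "quad (\<lambda>u v w z. a u v * a w z * a u w) = P"
proof -
  have "(\<Sum>v\<in>V. \<Sum>w\<in>V. \<Sum>z\<in>V. a u v * a w z * a u w) = (\<Sum>v\<in>V. a u v * d u * d v)" for u
  proof -
    have "(\<Sum>v\<in>V. \<Sum>w\<in>V. \<Sum>z\<in>V. a u v * a w z * a u w) =
        (\<Sum>v\<in>V. \<Sum>w\<in>V. a u v * (a u w * d w))"
      by (simp add: d_def sum_distrib_left mult_ac)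
    also have "\<dots> = d u * (\<Sum>w\<in>V. a u w * d w)"
      by (simp add: d_def sum_product)
    finally show ?thesis by (simp add: sum_distrib_left mult_ac)
  qed
  then show ?thesis by (simp add: quad_def P_def)
qed

lemma quad_edges: "quad (\<lambda>u v w z. a u v * a w z) = (\<Sum>u\<in>V. d u)\<^sup>2"
proof -
  have "quad (\<lambda>u v w z. a u v * a w z) = (\<Sum>u\<in>V. \<Sum>v\<in>V. a u v * (\<Sum>w\<in>V. d w))"
    by (simp add: quad_def d_def sum_distrib_left)
  also have "\<dots> = (\<Sum>u\<in>V. d u)\<^sup>2"
    by (simp add: d_def power2_eq_square sum_distrib_right)
  finally show ?thesis .
qed

text \<open>The closed walk is \<open>u v z w\<close>. For fixed opposite vertices \<open>u\<close>
  and \<open>z\<close>, the vertices \<open>v\<close> and \<open>w\<close> range independently over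
  common neighbours.\<close>

lemma quad_cycle: "quad (\<lambda>u v w z. a u v * a w z * (a u w * a v z)) = Q"
proof -
  have "(\<Sum>v\<in>V. \<Sum>w\<in>V. \<Sum>z\<in>V. a u v * a w z * (a u w * a v z)) = (\<Sum>z\<in>V. (c u z)\<^sup>2)" for u
  proof -
    have "(\<Sum>v\<in>V. \<Sum>w\<in>V. \<Sum>z\<in>V. a u v * a w z * (a u w * a v z)) =
        (\<Sum>v\<in>V. \<Sum>z\<in>V. \<Sum>w\<in>V. (a u v * a v z) * (a u w * a w z))"
      by (rule sum.cong[OF refl], subst sum.swap) (simp add: mult_ac)
    also have "\<dots> = (\<Sum>z\<in>V. \<Sum>v\<in>V. \<Sum>w\<in>V. (a u v * a v z) * (a u w * a w z))"
      by (rule sum.swap)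
    also have "\<dots> = (\<Sum>z\<in>V. (c u z)\<^sup>2)"
      by (simp add: c_def power2_eq_square sum_product a_sym)
    finally show ?thesis .
  qed
  then show ?thesis by (simp add: quad_def Q_def)
qed

text \<open>Counts the induced pairs of independent edges \<open>uv\<close>, \<open>wz\<close>; the factors vanish if vertices
  coincide.\<close>

definition two_edges :: "'a \<Rightarrow> 'a \<Rightarrow> 'a \<Rightarrow> 'a \<Rightarrow> real" where
  "two_edges u v w z = a u v * a w z * ((1 - a u w) * (1 - a u z) * (1 - a v w) * (1 - a v z))"

text \<open>Each of the four cross edges yields walks of length 3. Of the six pairs of cross edges,
  the two disjoint ones close a 4-cycle and the four sharing a vertex create a triangle.\<close>

lemma quad_two_edges_le: "quad two_edges \<le> (\<Sum>u\<in>V. d u)\<^sup>2 - 4 * P + 2 * Q + 4 * m * N ^ 3"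
proof -
  let ?e = "\<lambda>u v w z. a u v * a w z"
  have p: "quad (\<lambda>u v w z. ?e u v w z * a u w) = P" (is "quad ?p = _")
    "quad (\<lambda>u v w z. ?e u v w z * a u z) = P"
    "quad (\<lambda>u v w z. ?e u v w z * a v w) = P"
    "quad (\<lambda>u v w z. ?e u v w z * a v z) = P"
  proof -
    show p: "quad (\<lambda>u v w z. ?e u v w z * a u w) = P" by (rule quad_path)
    show q: "quad (\<lambda>u v w z. ?e u v w z * a u z) = P"
      using quad_swap34[of ?p] p by (simp add: a_sym)
    show "quad (\<lambda>u v w z. ?e u v w z * a v w) = P"
      using quad_swap12[of ?p] p by (simp add: a_sym)
    show "quad (\<lambda>u v w z. ?e u v w z * a v z) = P"
      using quad_swap12[of "\<lambda>u v w z. ?e u v w z * a u z"] q by (simp add: a_sym)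
  qed
  have q: "quad (\<lambda>u v w z. ?e u v w z * (a u w * a v z)) = Q" (is "quad ?q = _")
    "quad (\<lambda>u v w z. ?e u v w z * (a u z * a v w)) = Q"
    using quad_cycle quad_swap34[of ?q] by (simp_all add: a_sym)
  have t: "quad (\<lambda>u v w z. ?e u v w z * (a u w * a u z)) \<le> m * N ^ 3"
    "quad (\<lambda>u v w z. ?e u v w z * (a v w * a v z)) \<le> m * N ^ 3"
    "quad (\<lambda>u v w z. ?e u v w z * (a u z * a v z)) \<le> m * N ^ 3"
    "quad (\<lambda>u v w z. ?e u v w z * (a u w * a v w)) \<le> m * N ^ 3"
  proof -
    show "quad (\<lambda>u v w z. ?e u v w z * (a u w * a u z)) \<le> m * N ^ 3"
      by (rule quad_triangle[where f = "\<lambda>u v w. u" and g = "\<lambda>u v w. w"]) (auto simp: a_def)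
    show "quad (\<lambda>u v w z. ?e u v w z * (a v w * a v z)) \<le> m * N ^ 3"
      by (rule quad_triangle[where f = "\<lambda>u v w. v" and g = "\<lambda>u v w. w"]) (auto simp: a_def)
    show t: "quad (\<lambda>u v w z. ?e u v w z * (a u z * a v z)) \<le> m * N ^ 3" (is "quad ?t \<le> _")
      by (rule quad_triangle[where f = "\<lambda>u v w. u" and g = "\<lambda>u v w. v"]) (auto simp: a_def)
    show "quad (\<lambda>u v w z. ?e u v w z * (a u w * a v w)) \<le> m * N ^ 3"
      using t quad_swap34[of ?t] by (simp add: a_sym)
  qed
  \<comment> \<open>Bonferroni's inequality for the four possible edges between \<open>uv\<close> and \<open>wz\<close>\<close>
  have "quad two_edges \<le> quad (\<lambda>u v w z. ?e u v w z
      - ?e u v w z * a u w - ?e u v w z * a u z - ?e u v w z * a v w - ?e u v w z * a v z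
      + ?e u v w z * (a u w * a v z) + ?e u v w z * (a u z * a v w)
      + ?e u v w z * (a u w * a u z) + ?e u v w z * (a v w * a v z)
      + ?e u v w z * (a u z * a v z) + ?e u v w z * (a u w * a v w))"
    by (rule quad_mono) (simp add: two_edges_def a_def)
  also have "\<dots> \<le> (\<Sum>u\<in>V. d u)\<^sup>2 - 4 * P + 2 * Q + 4 * m * N ^ 3"
    using t unfolding quad_add quad_diff p q quad_edges by linarith
  finally show ?thesis .
qed

text \<open>By Cauchy-Schwarz, in the form of a sum of squared differences, and \<open>N\<close>
  \<le> \<open>2 * (n + 2)\<close>, twice the path inequality bounds the squared degree sum by
  \<open>4 * P - 2 * Q + 4 * m * N ^ 3\<close>. The walk counts then cancel.\<close>

lemma few_induced_two_edges:
  assumes "m \<ge> 1"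
  shows "quad two_edges \<le> 8 * m * N ^ 3"
proof -
  let ?D = "\<Sum>u\<in>V. (d u)\<^sup>2"
  have "0 \<le> (\<Sum>u\<in>V. \<Sum>v\<in>V. (d u - d v)\<^sup>2)" by (intro sum_nonneg) auto
  also have "\<dots> = 2 * N * ?D - 2 * (\<Sum>u\<in>V. d u)\<^sup>2"
    by (simp add: power2_diff sum.distrib sum_subtractf real_card_V algebra_simps
        power2_eq_square sum_product sum_distrib_left)
  finally have "(\<Sum>u\<in>V. d u)\<^sup>2 \<le> N * ?D" by simp
  moreover have "N * ?D \<le> (2 * (real n + 2)) * ?D"
    by (intro mult_right_mono sum_nonneg) (auto simp: N_def)
  ultimately show ?thesis
    using quad_two_edges_le path_inequality[OF assms] by (simp add: algebra_simps)
qed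

section \<open>From degrees to nested neighbourhoods\<close>

text \<open>Non-adjacent vertices have degree sum at least \<open>n + 2\<close>, more than
  \<open>N / 2\<close>. So the low-degree vertices form a clique, and an edge of it has all the
  others as common neighbours.\<close>

lemma few_low_degrees: "card {u \<in> V. 4 * d u < N} \<le> m + 1"
proof (rule ccontr)
  let ?L = "{u \<in> V. 4 * d u < N}"
  assume many: "\<not> ?thesis"
  then have "2 \<le> card ?L" by simp
  then obtain K where K: "K \<subseteq> ?L" "card K = 2" by (rule obtain_subset_with_card_n)
  then obtain u v where uv: "u \<in> ?L" "v \<in> ?L" "u \<noteq> v" by (auto simp: card_2_iff)
  have adj: "E x y" if "x \<in> ?L" "y \<in> ?L" "x \<noteq> y" for x y
  proof (rule ccontr)
    assume "\<not> E x y"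
    then have "real n + 2 \<le> d x + d y - c x y" using that by (intro c_nonedge) auto
    moreover have "4 * d x < N" "4 * d y < N" using that by auto
    ultimately show False using c_nonneg[of x y] unfolding N_def by linarith
  qed
  have "card (?L - {u, v}) \<le> card {w \<in> V. E u w \<and> E v w}"
    by (rule card_mono) (use adj uv in auto)
  also have "\<dots> < m" using edge[of u v] adj uv by auto
  finally have "card (?L - {u, v}) < m" .
  moreover have "card (?L - {u, v}) = card ?L - 2"
    using uv by (subst card_Diff_subset) auto
  ultimately show False using many by linarith
qed

lemma sum_degrees_ge:
  assumes "m \<ge> 1" "W \<subseteq> V"
  shows "(card W - 2 * real m) * (N / 4) \<le> (\<Sum>w\<in>W. d w)"
proof -
  let ?L = "{u \<in> V. 4 * d u < N}"
  have fW: "finite W" using assms(2) fin by (rule finite_subset)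
  have "card W \<le> card (W - ?L) + card ?L"
    using card_mono[of "(W - ?L) \<union> ?L" W] card_Un_le[of "W - ?L" ?L] fW by fastforce
  then have "card W - 2 * real m \<le> card (W - ?L)"
    using few_low_degrees assms(1) by linarith
  then have "(card W - 2 * real m) * (N / 4) \<le> card (W - ?L) * (N / 4)"
    by (intro mult_right_mono) (auto simp: N_def)
  also have "\<dots> = (\<Sum>w\<in>W - ?L. N / 4)" by simp
  also have "\<dots> \<le> (\<Sum>w\<in>W - ?L. d w)"
    by (rule sum_mono) (use assms in auto)
  also have "\<dots> \<le> (\<Sum>w\<in>W. d w)"
    by (rule sum_mono2) (use fW d_bounds in auto)
  finally show ?thesis .
qed

text \<open>Many walks of length 2 start at a vertex \<open>v\<close> of degree at least
  \<open>N / 4\<close>, so the set \<open>W\<close> of vertices with large codegree to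
  \<open>v\<close> is large. Averaging the degree sum of \<open>W\<close> over all vertices gives a
  \<open>u\<close> adjacent to many members of \<open>W\<close>.\<close>

lemma obtain_popular:
  assumes m: "m \<ge> 1" and N: "1000 * real m \<le> N"
  obtains u v A where "u \<in> V" "v \<in> V" "A \<subseteq> {w \<in> V. E u w}"
    "\<forall>w\<in>A. N / 40 \<le> c v w" "N / 200 \<le> card A"
proof -
  have N0: "N > 0" by (simp add: N_def)
  have Vne: "V \<noteq> {}" using card_V by auto
  have "card {u \<in> V. 4 * d u < N} < card V"
    using few_low_degrees N m real_card_V by linarith
  then have "{u \<in> V. 4 * d u < N} \<noteq> V" by (metis less_irrefl)
  then obtain v where "v \<in> V" "\<not> 4 * d v < N" by blast
  then have v: "v \<in> V" "N / 4 \<le> d v" by simp_all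
  let ?B = "{p \<in> V. E v p}"
  have "(card ?B - 2 * real m) * (N / 4) \<le> (\<Sum>p\<in>?B. d p)"
    by (rule sum_degrees_ge[OF m]) auto
  also have "\<dots> = (\<Sum>w\<in>V. c v w)"
    unfolding sum_c_row sum.inter_filter[OF fin] by (intro sum.cong) (auto simp: a_def)
  finally have s: "(d v - 2 * real m) * (N / 4) \<le> (\<Sum>w\<in>V. c v w)" by (simp add: d_card)
  define W where "W = {w \<in> V. N / 40 \<le> c v w}"
  \<comment> \<open>Codegrees are at most \<open>N\<close> on \<open>W\<close> and below
    \<open>N / 40\<close> elsewhere; the total is at least \<open>N * (N / 20)\<close>, so half of
    it comes from \<open>W\<close>.\<close>
  have "c v w \<le> of_bool (w \<in> W) * N + N / 40" if "w \<in> V" for w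
    using that c_le_d[of v w] d_bounds(2)[of v] N0 by (auto simp: W_def)
  then have "(\<Sum>w\<in>V. c v w) \<le> (\<Sum>w\<in>V. of_bool (w \<in> W) * N + N / 40)"
    by (rule sum_mono)
  also have "\<dots> = card W * N + N * (N / 40)"
    by (simp add: sum.distrib real_card_V W_def Int_def flip: sum_distrib_right)
  finally have "(\<Sum>w\<in>V. c v w) \<le> N * (card W + N / 40)" by (simp add: algebra_simps)
  moreover have "N * (N / 20) \<le> (d v - 2 * real m) * (N / 4)"
  proof -
    have "N / 5 * (N / 4) \<le> (d v - 2 * real m) * (N / 4)"
      using v N N0 by (intro mult_right_mono) auto
    then show ?thesis by simp
  qed
  ultimately have "N * (N / 20) \<le> N * (card W + N / 40)" using s by linarith
  then have W: "N / 40 \<le> card W" using N0 by (subst (asm) mult_le_cancel_left_pos) auto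
  have WV: "W \<subseteq> V" by (auto simp: W_def)
  obtain u where u: "u \<in> V" "(\<Sum>u\<in>V. \<Sum>w\<in>W. a u w) \<le> card V * (\<Sum>w\<in>W. a u w)"
    using exists_ge_average[OF fin Vne, of "\<lambda>u. \<Sum>w\<in>W. a u w"] by auto
  have "N * (N / 200) \<le> (card W - 2 * real m) * (N / 4)"
  proof -
    have "N / 50 * (N / 4) \<le> (card W - 2 * real m) * (N / 4)"
      using W N N0 by (intro mult_right_mono) auto
    then show ?thesis by simp
  qed
  also have "\<dots> \<le> (\<Sum>w\<in>W. d w)"
    by (rule sum_degrees_ge[OF m WV])
  also have "\<dots> = (\<Sum>u\<in>V. \<Sum>w\<in>W. a u w)"
    by (subst sum.swap) (simp add: d_def a_sym)
  also have "\<dots> \<le> N * (\<Sum>w\<in>W. a u w)" using u real_card_V by simp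
  finally have "N / 200 \<le> (\<Sum>w\<in>W. a u w)" using N0 by (subst (asm) mult_le_cancel_left_pos) auto
  also have "(\<Sum>w\<in>W. a u w) = card {w \<in> W. E u w}"
    using finite_subset[OF WV fin] by (simp add: a_def Int_def)
  finally show ?thesis
    using u v by (intro that[of u v "{w \<in> W. E u w}"]) (auto simp: W_def)
qed

text \<open>If neither of the traces of two neighbourhoods on \<open>N(v)\<close> contains the other,
  then private neighbours span a pair of independent edges.\<close>

definition excess :: "'a \<Rightarrow> 'a \<Rightarrow> 'a \<Rightarrow> nat" where
  "excess v w w' = card {p \<in> V. E v p \<and> E w p \<and> \<not> E w' p}"

text \<open>The product counts pairs \<open>p\<close>, \<open>q\<close> of private neighbours of
  \<open>w\<close> and \<open>w'\<close> inside the neighbourhood of \<open>v\<close>. Then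
  \<open>wp\<close> and \<open>w'q\<close> form an induced pair unless \<open>u w w'\<close> or
  \<open>v p q\<close> is a triangle, whence 10 = 8 + 1 + 1.\<close>

lemma sum_excess_le:
  assumes m: "m \<ge> 1" and uv: "u \<in> V" "v \<in> V" and A: "A \<subseteq> {w \<in> V. E u w}"
  shows "(\<Sum>w\<in>A. \<Sum>w'\<in>A. real (excess v w w') * excess v w' w) \<le> 10 * m * N ^ 3"
proof -
  define g where "g w w' p = a v p * a w p * (1 - a w' p)" for w w' p
  have g: "real (excess v w w') = (\<Sum>p\<in>V. g w w' p)" for w w'
  proof -
    have "g w w' p = of_bool (E v p \<and> E w p \<and> \<not> E w' p)" for p
      by (simp add: g_def a_def)
    then show ?thesis by (simp add: excess_def Int_def)
  qed
  define h where "h w w' = a u w * a u w' * (real (excess v w w') * excess v w' w)" for w w'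
  have hn: "0 \<le> h w w'" for w w' by (simp add: h_def)
  have AV: "A \<subseteq> V" using A by auto
  have "(\<Sum>w\<in>A. \<Sum>w'\<in>A. real (excess v w w') * excess v w' w) = (\<Sum>w\<in>A. \<Sum>w'\<in>A. h w w')"
    by (intro sum.cong refl) (use A in \<open>auto simp: h_def a_def\<close>)
  also have "\<dots> \<le> (\<Sum>w\<in>A. \<Sum>w'\<in>V. h w w')"
    by (intro sum_mono sum_mono2) (use AV hn in auto)
  also have "\<dots> \<le> (\<Sum>w\<in>V. \<Sum>w'\<in>V. h w w')"
    by (intro sum_mono2 sum_nonneg) (use AV hn in auto)
  also have "\<dots> = (\<Sum>w\<in>V. \<Sum>w'\<in>V. \<Sum>p\<in>V. \<Sum>q\<in>V. a u w * a u w' * (g w w' p * g w' w q))"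
    by (simp only: h_def g sum_product) (simp only: sum_distrib_left)
  also have "\<dots> = quad (\<lambda>w p w' q. a u w * a u w' * (g w w' p * g w' w q))"
    unfolding quad_def by (intro sum.cong refl sum.swap)
  also have "\<dots> \<le> quad (\<lambda>w p w' q. two_edges w p w' q + a u w * a w w' * a u w' + a v p * a p q * a v q)"
    by (rule quad_mono) (simp add: two_edges_def g_def a_def sym_iff)
  also have "\<dots> = quad two_edges + quad (\<lambda>w p w' q. a u w * a w w' * a u w') +
      quad (\<lambda>w p w' q. a v p * a p q * a v q)"
    by (simp add: quad_add)
  also have "quad (\<lambda>w p w' q. a u w * a w w' * a u w') =
      quad (\<lambda>w p q z. a u w * a w z * a u z)"
    using quad_swap34[of "\<lambda>w p q z. a u w * a w z * a u z"] .
  finally have *: "(\<Sum>w\<in>A. \<Sum>w'\<in>A. real (excess v w w') * excess v w' w) \<le>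
      quad two_edges + quad (\<lambda>w p q z. a u w * a w z * a u z) +
      quad (\<lambda>w p w' q. a v p * a p q * a v q)" .
  have "quad (\<lambda>w p q z. a u w * a w z * a u z) \<le> m * N ^ 3"
    by (rule quad_triangle[where f = "\<lambda>w p q. u" and g = "\<lambda>w p q. w"])
      (use uv in \<open>auto simp: mult_ac\<close>)
  moreover have "quad (\<lambda>w p w' q. a v p * a p q * a v q) \<le> m * N ^ 3"
    by (rule quad_triangle[where f = "\<lambda>w p q. v" and g = "\<lambda>w p q. p"])
      (use uv in \<open>auto simp: mult_ac\<close>)
  ultimately show ?thesis using * few_induced_two_edges[OF m] by simp
qed

text \<open>Pairs that are far from nested in both directions are rare, so the relation
  \<open>R\<close> or its converse holds for at least half of all pairs. Thus \<open>R\<close> has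
  density at least 1/4, and some \<open>w\<close> attains the average.\<close>

lemma obtain_nested:
  assumes m: "m \<ge> 1" and N: "2 * 10 ^ 12 * real m \<le> N"
    and uv: "u \<in> V" "v \<in> V" and A: "A \<subseteq> {w \<in> V. E u w}" "N / 200 \<le> card A"
  obtains w where "w \<in> A" "card A \<le> 4 * card {w' \<in> A. real (excess v w w') \<le> N / 1280}"
proof -
  let ?e = "excess v"
  define \<delta> where "\<delta> = N / 1280"
  have N0: "N > 0" by (simp add: N_def)
  have fA: "finite A" using A(1) by (rule finite_subset) auto
  have \<delta>0: "0 \<le> \<delta>" using N0 by (simp add: \<delta>_def)
  define Bad where "Bad = {(w, w'). w \<in> A \<and> w' \<in> A \<and> \<delta> < ?e w w' \<and> \<delta> < ?e w' w}"
  define R where "R = {(w, w'). w \<in> A \<and> w' \<in> A \<and> real (?e w w') \<le> \<delta>}"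
  have sub: "Bad \<subseteq> A \<times> A" "R \<subseteq> A \<times> A" by (auto simp: Bad_def R_def)
  have f: "finite Bad" "finite R" using sub fA by (auto intro: finite_subset)
  have "\<delta>\<^sup>2 * card Bad = (\<Sum>(w, w')\<in>Bad. \<delta> * \<delta>)"
    by (simp add: power2_eq_square case_prod_beta)
  also have "\<dots> \<le> (\<Sum>(w, w')\<in>Bad. real (?e w w') * ?e w' w)"
    using \<delta>0 by (intro sum_mono) (auto simp: Bad_def intro!: mult_mono)
  also have "\<dots> \<le> (\<Sum>(w, w')\<in>A \<times> A. real (?e w w') * ?e w' w)"
    by (rule sum_mono2) (use sub fA in auto)
  also have "\<dots> \<le> 10 * m * N ^ 3"
    using sum_excess_le[OF m uv A(1)] by (simp add: sum.cartesian_product)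
  finally have "N\<^sup>2 * card Bad \<le> N\<^sup>2 * (16384000 * m * N)"
    by (simp add: \<delta>_def power2_eq_square power3_eq_cube field_simps)
  then have "card Bad \<le> 16384000 * m * N"
    using N0 by (subst (asm) mult_le_cancel_left_pos) auto
  \<comment> \<open>Here 16384000 is 10 times the square of 1280. Its product with 80000 is about
    1.3 times \<open>10 ^ 12\<close>, which the assumption on \<open>N\<close> covers.\<close>
  also have "\<dots> \<le> N / 80000 * N"
    using N N0 by (intro mult_right_mono) auto
  also have "\<dots> = (N / 200)\<^sup>2 / 2" by (simp add: power2_eq_square)
  also have "\<dots> \<le> (real (card A))\<^sup>2 / 2"
    using A N0 by (intro divide_right_mono power_mono) auto
  finally have Bad: "card Bad \<le> (real (card A))\<^sup>2 / 2" .
  have "A \<times> A \<subseteq> (R \<union> R\<inverse>) \<union> Bad" by (auto simp: R_def Bad_def)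
  then have "card (A \<times> A) \<le> card ((R \<union> R\<inverse>) \<union> Bad)"
    by (rule card_mono[rotated]) (use f in auto)
  also have "\<dots> \<le> card R + card (R\<inverse>) + card Bad"
    by (meson add_right_mono card_Un_le order_trans)
  finally have "card A * card A \<le> 2 * card R + card Bad"
    by (simp add: card_cartesian_product card_inverse)
  then have "real (card A * card A) \<le> real (2 * card R + card Bad)" by (simp only: of_nat_le_iff)
  with Bad have R: "real (card A) * card A \<le> 4 * card R" by (simp add: power2_eq_square)
  have "R = (SIGMA w:A. {w' \<in> A. real (?e w w') \<le> \<delta>})" by (auto simp: R_def)
  then have "card R = (\<Sum>w\<in>A. card {w' \<in> A. real (?e w w') \<le> \<delta>})"
    using fA by simp
  moreover have Ane: "A \<noteq> {}" using A(2) N0 by auto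
  ultimately obtain w where w: "w \<in> A"
      "real (card R) \<le> card A * real (card {w' \<in> A. real (?e w w') \<le> \<delta>})"
    using exists_ge_average[OF fA Ane, of "\<lambda>w. real (card {w' \<in> A. real (?e w w') \<le> \<delta>})"]
    by auto
  have "real (card A) * card A \<le> card A * (4 * real (card {w' \<in> A. real (?e w w') \<le> \<delta>}))"
    using R w(2) by linarith
  then have "real (card A) \<le> 4 * real (card {w' \<in> A. real (?e w w') \<le> \<delta>})"
    using Ane fA by (subst (asm) mult_le_cancel_left_pos) (auto simp: card_gt_0_iff)
  then show ?thesis using w(1) by (intro that[of w]) (simp_all add: \<delta>_def)
qed

section \<open>Building a nearly complete pair\<close>

text \<open>Every vertex of \<open>S\<close> is adjacent to almost all common neighbours
  \<open>T0\<close> of \<open>v\<close> and \<open>w\<close>. Deleting from \<open>T0\<close> the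
  vertices that miss more than a sixteenth of \<open>S\<close> makes the pair nearly complete from
  both sides.\<close>

lemma order_bounded:
  assumes m: "m \<ge> 1" and N: "2 * 10 ^ 12 * real m \<le> N"
  shows False
proof -
  have N0: "N > 0" by (simp add: N_def)
  have N': "1000 * real m \<le> N" using N by simp
  obtain u v A where uv: "u \<in> V" "v \<in> V" and A: "A \<subseteq> {w \<in> V. E u w}"
    "\<forall>w\<in>A. N / 40 \<le> c v w" "N / 200 \<le> card A"
    by (rule obtain_popular[OF m N'])
  obtain w where w: "w \<in> A" "card A \<le> 4 * card {w' \<in> A. real (excess v w w') \<le> N / 1280}"
    using obtain_nested[OF m N uv A(1,3)] by metis
  define S where "S = {w' \<in> A. real (excess v w w') \<le> N / 1280}"
  define T0 where "T0 = {p \<in> V. E v p \<and> E w p}"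
  define T where "T = {p \<in> T0. 16 * card {w' \<in> S. \<not> E p w'} \<le> card S}"
  have SV: "S \<subseteq> V" and TV: "T \<subseteq> V" using A(1) by (auto simp: S_def T_def T0_def)
  have f: "finite S" "finite T0" "finite T"
    using finite_subset[OF SV fin] finite_subset[OF TV fin] by (auto simp: T0_def)
  have S: "N / 800 \<le> card S" using w(2) A(3) by (simp add: S_def)
  have T0: "N / 40 \<le> card T0" using A(2) w(1) by (simp add: c_card T0_def)
  have miss: "real (card {p \<in> T0. \<not> E w' p}) \<le> N / 1280" if "w' \<in> S" for w'
  proof -
    have "{p \<in> T0. \<not> E w' p} = {p \<in> V. E v p \<and> E w p \<and> \<not> E w' p}" by (auto simp: T0_def)
    with that show ?thesis by (simp add: S_def excess_def)
  qed
  have "card S * card (T0 - T) \<le> (\<Sum>p\<in>T0 - T. 16 * card {w' \<in> S. \<not> E p w'})"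
  proof -
    have "(\<Sum>p\<in>T0 - T. card S) \<le> (\<Sum>p\<in>T0 - T. 16 * card {w' \<in> S. \<not> E p w'})"
      by (rule sum_mono) (auto simp: T_def)
    then show ?thesis by (simp add: mult.commute)
  qed
  also have "\<dots> \<le> (\<Sum>p\<in>T0. 16 * card {w' \<in> S. \<not> E p w'})"
    by (rule sum_mono2) (use f in auto)
  also have "\<dots> = 16 * (\<Sum>w'\<in>S. card {p \<in> T0. \<not> E w' p})"
    using sum_multicount_gen[OF f(1,2), of "\<lambda>w' p. \<not> E w' p" "\<lambda>p. card {w' \<in> S. \<not> E p w'}"]
    by (simp add: sum_distrib_left[symmetric] sym_iff)
  finally have "real (card S * card (T0 - T)) \<le> real (16 * (\<Sum>w'\<in>S. card {p \<in> T0. \<not> E w' p}))"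
    by (simp only: of_nat_le_iff)
  also have "\<dots> = 16 * (\<Sum>w'\<in>S. real (card {p \<in> T0. \<not> E w' p}))" by simp
  also have "\<dots> \<le> 16 * (\<Sum>w'\<in>S. N / 1280)"
    using miss by (intro mult_left_mono sum_mono) auto
  also have "\<dots> = card S * (N / 80)" by simp
  finally have "card S * real (card (T0 - T)) \<le> card S * (N / 80)" by simp
  \<comment> \<open>The tolerance \<open>N / 1280\<close> is a sixteenth of \<open>N / 80\<close>.
    Thus at most half of the guaranteed \<open>N / 40\<close> vertices are deleted, and a vertex of
    \<open>S\<close> misses at most a sixteenth of what remains.\<close>
  then have "card (T0 - T) \<le> N / 80"
    using S N0 by (subst (asm) mult_le_cancel_left_pos) auto
  moreover have "card T0 = card T + card (T0 - T)"
    using card_Un_disjoint[of T "T0 - T"] f by (auto simp: T_def Un_absorb1)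
  ultimately have T: "N / 80 \<le> card T" using T0 by simp
  have sizes: "real 4 \<le> real (card S)" "real 4 \<le> real (card T)"
      "real (16 * m) \<le> real (card S)" "real (16 * m) \<le> real (card T)"
    using S T N m by simp_all
  show False
  proof (rule near_complete_pair_impossible[OF SV TV])
    show "4 \<le> card S" "4 \<le> card T" "16 * m \<le> card S" "16 * m \<le> card T"
      using sizes by (simp_all only: of_nat_le_iff)
    show "16 * card {p \<in> T. \<not> E w' p} \<le> card T" if "w' \<in> S" for w'
    proof -
      have "card {p \<in> T. \<not> E w' p} \<le> card {p \<in> T0. \<not> E w' p}"
        by (rule card_mono) (use f in \<open>auto simp: T_def\<close>)
      with miss[OF that] T show ?thesis by linarith
    qed
    show "16 * card {w' \<in> S. \<not> E p w'} \<le> card S" if "p \<in> T" for p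
      using that by (simp add: T_def)
  qed
qed

end

section \<open>Upper bound and conclusion\<close>

lemma book_ramsey_upper:
  fixes G :: "'a graph"
  assumes G: "finite_simple_graph G" "card (verts G) = 2 * n + 3"
    and m: "m \<ge> 1" "10 ^ 12 * real m \<le> n"
  shows "contains_subgraph G (book m) \<or> contains_subgraph (complement G) (book n)"
proof (rule ccontr)
  assume "\<not> ?thesis"
  then have not: "\<not> contains_subgraph G (book m)" "\<not> contains_subgraph (complement G) (book n)"
    by auto
  have no: "card {w. {u, w} \<in> edges G \<and> {v, w} \<in> edges G} < m" if "{u, v} \<in> edges G" for u v
    using not(1) that unfolding contains_book_iff[OF G(1)] by (meson not_le)
  have no': "card {w. {u, w} \<in> edges (complement G) \<and> {v, w} \<in> edges (complement G)} < n"
    if "{u, v} \<in> edges (complement G)" for u v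
    using not(2) that unfolding contains_book_iff[OF finite_simple_graph_complement[OF G(1)]]
    by (meson not_le)
  have sub: "u \<in> verts G \<and> v \<in> verts G \<and> u \<noteq> v" if "{u, v} \<in> edges G" for u v
    using G(1) that pair_in_all_pairs[of u v "verts G"] by (auto simp: finite_simple_graph_def)
  have compl: "{u, v} \<in> edges (complement G) \<longleftrightarrow>
      u \<in> verts G \<and> v \<in> verts G \<and> u \<noteq> v \<and> {u, v} \<notin> edges G" for u v
    by (auto simp: complement_def pair_in_all_pairs)
  interpret book_free "verts G" "\<lambda>u v. {u, v} \<in> edges G" m n
  proof
    show "finite (verts G)" using G(1) by (simp add: finite_simple_graph_def)
    show "card (verts G) = 2 * n + 3" by (rule G(2))
    show "{v, u} \<in> edges G" if "{u, v} \<in> edges G" for u v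
      using that by (simp add: insert_commute)
    show "{u, u} \<notin> edges G" for u using sub by blast
    show "card {w \<in> verts G. {u, w} \<in> edges G \<and> {v, w} \<in> edges G} < m"
      if "{u, v} \<in> edges G" for u v
    proof -
      have "{w \<in> verts G. {u, w} \<in> edges G \<and> {v, w} \<in> edges G} =
          {w. {u, w} \<in> edges G \<and> {v, w} \<in> edges G}"
        using sub by blast
      with no[OF that] show ?thesis by simp
    qed
    show "card {w \<in> verts G - {u, v}. {u, w} \<notin> edges G \<and> {v, w} \<notin> edges G} < n"
      if uv: "u \<in> verts G" "v \<in> verts G" "u \<noteq> v" "{u, v} \<notin> edges G" for u v
    proof -
      have "{w \<in> verts G - {u, v}. {u, w} \<notin> edges G \<and> {v, w} \<notin> edges G} =
          {w. {u, w} \<in> edges (complement G) \<and> {v, w} \<in> edges (complement G)}"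
        using uv by (auto simp: compl)
      with no'[of u v] uv show ?thesis by (simp add: compl)
    qed
  qed
  \<comment> \<open>From \<open>n\<close> \<ge> \<open>10 ^ 12 * m\<close> follows
    \<open>N = 2 * n + 3\<close> \<ge> \<open>2 * 10 ^ 12 * m\<close>.\<close>
  show False
    by (rule order_bounded[OF m(1)]) (use m(2) in \<open>simp add: N_def\<close>)
qed

theorem theorem5:
  shows "\<exists>c::real. c > 0 \<and>
    (\<forall>m n :: nat. m \<ge> 1 \<and> n \<ge> 1 \<and> real n \<ge> c * real m \<longrightarrow> book_ramsey m n = 2 * n + 3)"
proof (intro exI[of _ "10 ^ 12"] conjI allI impI)
  fix m n :: nat
  assume mn: "m \<ge> 1 \<and> n \<ge> 1 \<and> real n \<ge> 10 ^ 12 * real m"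
  show "book_ramsey m n = 2 * n + 3"
    unfolding book_ramsey_def
  proof (rule Least_equality)
    show "\<forall>G :: nat graph. finite_simple_graph G \<and> card (verts G) = 2 * n + 3 \<longrightarrow>
        contains_subgraph G (book m) \<or> contains_subgraph (complement G) (book n)"
      using book_ramsey_upper mn by blast
    show "2 * n + 3 \<le> r"
      if "\<forall>G :: nat graph. finite_simple_graph G \<and> card (verts G) = r \<longrightarrow>
        contains_subgraph G (book m) \<or> contains_subgraph (complement G) (book n)" for r
      using that book_ramsey_lower[of m r n] mn by (meson not_le)
  qed
qed simp

end
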